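(* Let $f:\mathbb R\to\mathbb R$ be smooth, $I=[a,b]\subset\mathbb R$, and let $\rho_0:\mathbb R\to I$ be measurable. Define a change of unknown $\rho\mapsto\sigma$, a compact interval $\tilde I\subset(0,\infty)$ and a flux $h$ on $\tilde I$ as follows: (i) if $a>0$: $\sigma=\rho$, $\tilde I=I$, $h(\sigma)=f(\sigma)$; (ii) if $a\le0\le b$: $\sigma=\rho+L$, where $L\in\mathbb R$ is a constant with $I+L\subset(0,\infty)$, $\tilde I=I+L$, $h(\sigma)=f(\sigma-L)$; (iii) if $b<0$: $\sigma=-\rho$, $\tilde I=-I$, $h(\sigma)=-f(-\sigma)$. Let $K\in\mathbb R$ satisfy $K<\min_{\sigma\in\tilde I}\{\sigma h'(\sigma)-h(\sigma)\}$, let $g(\sigma)=h(\sigma)+K$, and let $\sigma_0$ be obtained from $\rho_0$ by the same change of unknown. Then the Cauchy problems $$\rho_t+f(\rho)_x=0,\quad\rho(x,0)=\rho_0(x)\qquad\text{and}\qquad\sigma_t+g(\sigma)_x=0,\quad\sigma(x,0)=\sigma_0(x)$$ on $\mathbb R\times(0,\infty)$ are equivalent: $\rho$ (with values in $I$) is an entropy admissible weak solution of the first if and only if the corresponding $\sigma$ (with values in $\tilde I$) is an entropy admissible weak solution of the second.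
   Context: For a scalar conservation law $u_t+\phi(u)_x=0$, $u(x,0)=u_0(x)$, with values in a compact interval $J$: Weak solution: a bounded measurable $u:\mathbb R\times[0,\infty)\to J$ such that $t\mapsto u(\cdot,t)$ is continuous from $[0,\infty)$ into $L^1_{loc}(\mathbb R)$, $u(\cdot,0)=u_0$, and the equation holds in the sense of distributions on $\mathbb R\times(0,\infty)$. Convex extension: a pair $(\mathcal E,\mathcal Q)$ of $\mathcal C^1$ functions with $\mathcal E$ smooth and convex and $\mathcal Q'(u)=\mathcal E'(u)\phi'(u)$. Entropy admissible weak solution: a weak solution such that for every convex extension $(\mathcal E,\mathcal Q)$ and every nonnegative $\psi\in\mathcal C^1_c(\mathbb R\times(0,\infty))$ one has $\iint(\psi_t\,\mathcal E(u)+\psi_x\,\mathcal Q(u))\,dx\,dt\ge0$. *)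

theory Defs
  imports "HOL-Analysis.Analysis"
begin

text \<open>Class \<open>C\<^sup>k\<close> on the whole space: all directional derivatives of order at most \<open>k\<close>
  exist as values of total derivatives and are continuous.\<close>

fun C_k :: "nat \<Rightarrow> ('a::euclidean_space \<Rightarrow> real) \<Rightarrow> bool" where
  "C_k 0 F \<longleftrightarrow> continuous_on UNIV F"
| "C_k (Suc k) F \<longleftrightarrow>
     (\<forall>x. F differentiable (at x)) \<and> (\<forall>v. C_k k (\<lambda>x. frechet_derivative F (at x) v))"

definition smooth :: "('a::euclidean_space \<Rightarrow> real) \<Rightarrow> bool" where
  "smooth F \<longleftrightarrow> (\<forall>k. C_k k F)"

text \<open>Points of the plane are pairs \<open>(x, t)\<close>, space first.\<close>

definition half_plane :: "(real \<times> real) set" where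
  "half_plane = UNIV \<times> {0<..}"

definition partial_x :: "(real \<times> real \<Rightarrow> real) \<Rightarrow> real \<times> real \<Rightarrow> real" where
  "partial_x \<psi> p = frechet_derivative \<psi> (at p) (1, 0)"

definition partial_t :: "(real \<times> real \<Rightarrow> real) \<Rightarrow> real \<times> real \<Rightarrow> real" where
  "partial_t \<psi> p = frechet_derivative \<psi> (at p) (0, 1)"

text \<open>A function with compact support in the open half-plane is identified with its extension
  by zero to the plane, so that \<open>C_k\<close> and \<open>smooth\<close> apply to it.\<close>

definition compact_support_in :: "(real \<times> real) set \<Rightarrow> (real \<times> real \<Rightarrow> real) \<Rightarrow> bool" where
  "compact_support_in S \<psi> \<longleftrightarrow>
     compact (closure {p. \<psi> p \<noteq> 0}) \<and> closure {p. \<psi> p \<noteq> 0} \<subseteq> S"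

text \<open>Continuity of \<open>t \<mapsto> u(\<cdot>, t)\<close> from \<open>[0, \<infinity>)\<close> into \<open>L\<^sup>1\<^sub>l\<^sub>o\<^sub>c\<close>, whose topology is given by the
  seminorms \<open>v \<mapsto> \<integral>\<^sub>C \<bar>v\<bar>\<close> for compact \<open>C\<close>.\<close>

definition continuous_into_L1loc :: "(real \<times> real \<Rightarrow> real) \<Rightarrow> bool" where
  "continuous_into_L1loc u \<longleftrightarrow>
     (\<forall>t\<ge>0. \<forall>C. compact C \<longrightarrow>
        set_integrable lebesgue C (\<lambda>x. u (x, t)) \<and>
        ((\<lambda>s. LINT x:C|lebesgue. \<bar>u (x, s) - u (x, t)\<bar>) \<longlongrightarrow> 0) (at t within {0..}))"

text \<open>Solutions are total functions on the plane of which only the values for \<open>t \<ge> 0\<close> matter.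
  The initial condition is an equality of elements of \<open>L\<^sup>1\<^sub>l\<^sub>o\<^sub>c\<close>, hence almost everywhere.\<close>

definition weak_solution ::
  "(real \<Rightarrow> real) \<Rightarrow> real set \<Rightarrow> (real \<Rightarrow> real) \<Rightarrow> (real \<times> real \<Rightarrow> real) \<Rightarrow> bool" where
  "weak_solution \<phi> J u0 u \<longleftrightarrow>
     (\<forall>x. \<forall>t\<ge>0. u (x, t) \<in> J) \<and>
     bounded (u ` (UNIV \<times> {0..})) \<and>
     u \<in> borel_measurable (lebesgue_on (UNIV \<times> {0..})) \<and>
     continuous_into_L1loc u \<and>
     (AE x in lebesgue. u (x, 0) = u0 x) \<and>
     (\<forall>\<psi>. smooth \<psi> \<and> compact_support_in half_plane \<psi> \<longrightarrow>
        (LINT p:half_plane|lebesgue. partial_t \<psi> p * u p + partial_x \<psi> p * \<phi> (u p)) = 0)"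

definition convex_extension ::
  "(real \<Rightarrow> real) \<Rightarrow> (real \<Rightarrow> real) \<Rightarrow> (real \<Rightarrow> real) \<Rightarrow> bool" where
  "convex_extension \<phi> E Q \<longleftrightarrow>
     C_k 1 E \<and> C_k 1 Q \<and> smooth E \<and> convex_on UNIV E \<and>
     (\<forall>v. deriv Q v = deriv E v * deriv \<phi> v)"

definition entropy_admissible_weak_solution ::
  "(real \<Rightarrow> real) \<Rightarrow> real set \<Rightarrow> (real \<Rightarrow> real) \<Rightarrow> (real \<times> real \<Rightarrow> real) \<Rightarrow> bool" where
  "entropy_admissible_weak_solution \<phi> J u0 u \<longleftrightarrow>
     weak_solution \<phi> J u0 u \<and>
     (\<forall>E Q \<psi>. convex_extension \<phi> E Q \<and>
        C_k 1 \<psi> \<and> compact_support_in half_plane \<psi> \<and> (\<forall>p. \<psi> p \<ge> 0) \<longrightarrow>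
        (LINT p:half_plane|lebesgue. partial_t \<psi> p * E (u p) + partial_x \<psi> p * Q (u p)) \<ge> 0)"

text \<open>For \<open>a \<le> b\<close> the three branches below are the cases \<open>a > 0\<close>, \<open>a \<le> 0 \<le> b\<close> and \<open>b < 0\<close>;
  the shift \<open>L\<close> plays a role only in the second one.  The new flux is given by its formula on
  the whole line, not only on the new interval.\<close>

definition change_unknown :: "real \<Rightarrow> real \<Rightarrow> real \<Rightarrow> real \<Rightarrow> real" where
  "change_unknown a b L r =
     (if a > 0 then r else if a \<le> 0 \<and> 0 \<le> b then r + L else - r)"

definition new_interval :: "real \<Rightarrow> real \<Rightarrow> real \<Rightarrow> real set" where
  "new_interval a b L =
     (if a > 0 then {a..b}
      else if a \<le> 0 \<and> 0 \<le> b then (\<lambda>r. r + L) ` {a..b}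
      else uminus ` {a..b})"

definition new_flux :: "(real \<Rightarrow> real) \<Rightarrow> real \<Rightarrow> real \<Rightarrow> real \<Rightarrow> real \<Rightarrow> real" where
  "new_flux f a b L \<sigma> =
     (if a > 0 then f \<sigma>
      else if a \<le> 0 \<and> 0 \<le> b then f (\<sigma> - L)
      else - f (- \<sigma>))"

end

theory Submission
  imports Defs
begin

text \<open>Each change of unknown is an affine involution \<open>r \<mapsto> s r + c\<close> with \<open>s = \<plusminus>1\<close>, and the new flux is
  \<open>v \<mapsto> s \<phi>(s (v - c)) + K\<close>.  Convex extensions correspond to each other under composition with this
  map.  In the weak formulation the constants \<open>c\<close> and \<open>K\<close> contribute \<open>\<integral> (c \<psi>\<^sub>t + K \<psi>\<^sub>x) = 0\<close>.
  The inverse of an admissible change is of the same form, so one implication suffices.\<close>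

section \<open>Regularity under affine substitution\<close>

text \<open>By the chain rule, the derivative of the composite in direction \<open>v\<close> is that
  of \<open>F\<close> in direction \<open>s * v\<close>, composed with the same affine map. Hence
  the induction runs over all \<open>F\<close>.\<close>

lemma C_k_affine:
  fixes F :: "real \<Rightarrow> real"
  assumes "C_k k F"
  shows "C_k k (\<lambda>x. F (s * x + c))"
  using assms
proof (induction k arbitrary: F)
  case 0
  then show ?case
    by (auto intro!: continuous_intros continuous_on_compose2[of UNIV F])
next
  case (Suc k)
  have der: "((\<lambda>x. F (s * x + c)) has_derivative
      (\<lambda>v. frechet_derivative F (at (s * x + c)) (s * v))) (at x)" for x
  proof -
    have d: "(F has_derivative frechet_derivative F (at (s * x + c))) (at (s * x + c))"
      using Suc.prems by (simp add: frechet_derivative_works[symmetric])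
    have a: "((\<lambda>x. s * x + c) has_derivative (\<lambda>v. s * v)) (at x)"
      by (auto intro!: derivative_eq_intros)
    show ?thesis
      by (rule has_derivative_compose[OF a d])
  qed
  have "(\<lambda>x. frechet_derivative (\<lambda>x. F (s * x + c)) (at x) v) =
      (\<lambda>x. frechet_derivative F (at (s * x + c)) (s * v))" for v
    using frechet_derivative_at[OF der] by metis
  moreover have "C_k k (\<lambda>x. frechet_derivative F (at (s * x + c)) (s * v))" for v
    using Suc.prems by (intro Suc.IH) auto
  ultimately show ?case
    using der by (auto simp: differentiable_def)
qed

lemma smooth_imp_differentiable:
  assumes "smooth F"
  shows "F differentiable (at x)"
proof -
  have "C_k 1 F"
    using assms by (simp add: smooth_def)
  then show ?thesis
    by simp
qed

section \<open>Integrals of derivatives of test functions\<close>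

lemma frechet_derivative_eq_0_outside_support:
  assumes "p \<notin> closure {q. \<psi> q \<noteq> 0}"
  shows "frechet_derivative \<psi> (at p) v = 0"
proof -
  have "(\<psi> has_derivative (\<lambda>v. 0)) (at p)"
    by (rule has_derivative_transform_within_open[of "\<lambda>_. 0" _ _ _ "- closure {q. \<psi> q \<noteq> 0}"])
      (use assms closure_subset[of "{q. \<psi> q \<noteq> 0}"] in auto)
  from frechet_derivative_at[OF this] show ?thesis
    by metis
qed

text \<open>The derivative is continuous and vanishes off the compact support, so it equals its
  product with the indicator of that set.\<close>

lemma integrable_frechet_derivative:
  fixes \<psi> :: "'a::euclidean_space \<Rightarrow> real"
  assumes "C_k 1 \<psi>" and "compact (closure {p. \<psi> p \<noteq> 0})"
  shows "integrable lborel (\<lambda>p. frechet_derivative \<psi> (at p) v)"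
proof -
  let ?S = "closure {p. \<psi> p \<noteq> 0}"
  have "integrable lborel (\<lambda>p. indicator ?S p *\<^sub>R frechet_derivative \<psi> (at p) v)"
    by (rule borel_integrable_compact) (use assms in \<open>auto intro: continuous_on_subset\<close>)
  also have "(\<lambda>p. indicator ?S p *\<^sub>R frechet_derivative \<psi> (at p) v) =
      (\<lambda>p. frechet_derivative \<psi> (at p) v)"
    by (auto simp: fun_eq_iff indicator_def frechet_derivative_eq_0_outside_support)
  finally show ?thesis .
qed

text \<open>The fundamental theorem of calculus applies along a line that leaves the support at both
  ends.\<close>

lemma integral_frechet_derivative_line:
  fixes \<psi> :: "'a::euclidean_space \<Rightarrow> real"
  assumes "C_k 1 \<psi>" and "compact (closure {p. \<psi> p \<noteq> 0})" and "w \<noteq> 0"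
  shows "(LINT r|lborel. frechet_derivative \<psi> (at (p + r *\<^sub>R w)) w) = 0"
proof -
  define G where "G r = frechet_derivative \<psi> (at (p + r *\<^sub>R w)) w" for r
  let ?S = "closure {p. \<psi> p \<noteq> 0}"
  obtain B where B: "norm q \<le> B" if "q \<in> ?S" for q
    using compact_imp_bounded[OF assms(2)] bounded_iff by blast
  \<comment> \<open>Beyond the quotient, \<open>p + r *\<^sub>R w\<close> has norm larger than
    \<open>B\<close>. Adding 1 makes the excess strict, and the maximum with 0 keeps
    \<open>M\<close> positive even if the quotient is negative.\<close>
  define M where "M = max 0 ((B + norm p) / norm w) + 1"
  have out: "p + r *\<^sub>R w \<notin> ?S" if "\<bar>r\<bar> \<ge> M" for r
  proof
    assume "p + r *\<^sub>R w \<in> ?S"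
    then have "norm (p + r *\<^sub>R w) \<le> B"
      by (rule B)
    moreover have "norm (r *\<^sub>R w) \<le> norm (p + r *\<^sub>R w) + norm p"
      using norm_triangle_ineq4[of "p + r *\<^sub>R w" p] by simp
    ultimately have "\<bar>r\<bar> * norm w \<le> B + norm p"
      by simp
    then have "\<bar>r\<bar> \<le> (B + norm p) / norm w"
      using assms(3) by (simp add: field_simps)
    then show False
      using that by (simp add: M_def)
  qed
  have zero: "\<psi> (p + r *\<^sub>R w) = 0" if "\<bar>r\<bar> \<ge> M" for r
    using out[OF that] closure_subset[of "{p. \<psi> p \<noteq> 0}"] by auto
  have der: "((\<lambda>r. \<psi> (p + r *\<^sub>R w)) has_real_derivative G r) (at r)" for r
  proof -
    have d: "(\<psi> has_derivative frechet_derivative \<psi> (at (p + r *\<^sub>R w))) (at (p + r *\<^sub>R w))"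
      using assms(1) by (simp add: frechet_derivative_works[symmetric])
    have "((\<lambda>r. \<psi> (p + r *\<^sub>R w)) has_derivative
        (\<lambda>h. frechet_derivative \<psi> (at (p + r *\<^sub>R w)) (h *\<^sub>R w))) (at r)"
      by (rule has_derivative_compose[where f = "\<lambda>r. p + r *\<^sub>R w", OF _ d])
        (auto intro!: derivative_eq_intros)
    then show ?thesis
      \<comment> \<open>Linearity turns the value at \<open>h *\<^sub>R w\<close> into
        \<open>h\<close> times the value at \<open>w\<close>, the shape of a real
        derivative.\<close>
      using linear_scale[OF has_derivative_linear[OF d]]
      by (simp add: has_field_derivative_def G_def mult.commute[of _ "frechet_derivative _ _ _"])
  qed
  have "continuous_on UNIV G"
    unfolding G_def using assms(1)
    by (intro continuous_on_compose2[of UNIV "\<lambda>q. frechet_derivative \<psi> (at q) w" UNIV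
          "\<lambda>r. p + r *\<^sub>R w"] continuous_intros) auto
  then have "isCont G r" for r
    by (simp add: continuous_on_eq_continuous_at)
  then have "(LINT r|lborel. G r * indicator {- M..M} r) =
      \<psi> (p + M *\<^sub>R w) - \<psi> (p + (- M) *\<^sub>R w)"
    using der by (intro integral_FTC_Icc_real) (auto simp: M_def)
  also have "\<dots> = 0"
    using zero[of M] zero[of "- M"] by (simp add: M_def)
  also have "(\<lambda>r. G r * indicator {- M..M} r) = G"
  proof
    show "G r * indicator {- M..M} r = G r" for r
      using frechet_derivative_eq_0_outside_support[OF out, of r w]
      by (cases "\<bar>r\<bar> \<ge> M") (auto simp: G_def indicator_def)
  qed
  finally show ?thesis
    by (simp add: G_def)
qed

text \<open>Fubini, with the differentiated variable innermost: each inner integral is the integral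
  over a line parallel to an axis, hence 0.\<close>

lemma integral_partial_derivatives:
  assumes "C_k 1 \<psi>" and "compact (closure {p. \<psi> p \<noteq> 0})"
  shows "(LINT p|lborel. partial_x \<psi> p) = 0" and "(LINT p|lborel. partial_t \<psi> p) = 0"
proof -
  have x: "(LINT x|lborel. frechet_derivative \<psi> (at (x, t)) (1, 0)) = 0" for t
    using integral_frechet_derivative_line[OF assms, of "(1, 0)" "(0, t)"] by (simp add: zero_prod_def)
  have t: "(LINT t|lborel. frechet_derivative \<psi> (at (x, t)) (0, 1)) = 0" for x
    using integral_frechet_derivative_line[OF assms, of "(0, 1)" "(x, 0)"] by (simp add: zero_prod_def)
  note int = integrable_frechet_derivative[OF assms, folded lborel_prod]
  show "(LINT p|lborel. partial_x \<psi> p) = 0"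
    using lborel_pair.integral_snd[of "\<lambda>x t. frechet_derivative \<psi> (at (x, t)) (1, 0)"]
      int[of "(1, 0)"]
    by (simp add: partial_x_def x lborel_prod case_prod_beta')
  show "(LINT p|lborel. partial_t \<psi> p) = 0"
    using lborel_pair.integral_fst'[OF int[of "(0, 1)"]]
    by (simp add: partial_t_def t lborel_prod)
qed

text \<open>Constants drop out of the weak formulation: both partial derivatives vanish off the
  half-plane, so the integrals are those over the whole plane.\<close>

lemma constants_weakly_trivial:
  assumes "C_k 1 \<psi>" and "compact_support_in half_plane \<psi>"
  shows "set_integrable lebesgue half_plane (\<lambda>p. c * partial_t \<psi> p + K * partial_x \<psi> p)"
    and "(LINT p:half_plane|lebesgue. c * partial_t \<psi> p + K * partial_x \<psi> p) = 0"
proof -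
  let ?F = "\<lambda>p. c * partial_t \<psi> p + K * partial_x \<psi> p"
  have supp: "compact (closure {p. \<psi> p \<noteq> 0})" "closure {p. \<psi> p \<noteq> 0} \<subseteq> half_plane"
    using assms(2) by (auto simp: compact_support_in_def)
  have restrict: "(\<lambda>p. indicator half_plane p *\<^sub>R ?F p) = ?F"
    using supp(2) frechet_derivative_eq_0_outside_support[of _ \<psi>]
    by (fastforce simp: fun_eq_iff indicator_def partial_t_def partial_x_def)
  have int: "integrable lborel (partial_x \<psi>)" "integrable lborel (partial_t \<psi>)"
    unfolding partial_x_def[abs_def] partial_t_def[abs_def]
    by (rule integrable_frechet_derivative[OF assms(1) supp(1)])+
  then have F: "integrable lborel ?F" and "integral\<^sup>L lborel ?F = 0"
    using integral_partial_derivatives[OF assms(1) supp(1)] by auto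
  then show "set_integrable lebesgue half_plane ?F" "(LINT p:half_plane|lebesgue. ?F p) = 0"
    unfolding set_integrable_def set_lebesgue_integral_def restrict
    \<comment> \<open>\<open>lebesgue\<close> is the completion of \<open>lborel\<close>, and the
      integral of a Borel function is the same for both.\<close>
    using integrable_completion[of ?F lborel] integral_completion[of ?F lborel]
      borel_measurable_integrable[OF F] by auto
qed

text \<open>Integrability of \<open>f\<close> is not required: if it fails, both integrals are \<open>0\<close> by convention.\<close>

lemma set_lebesgue_integral_add_null:
  fixes f g :: "'a \<Rightarrow> real"
  assumes "set_integrable M A g" and "(LINT x:A|M. g x) = 0"
  shows "(LINT x:A|M. f x + g x) = (LINT x:A|M. f x)"
proof (cases "set_integrable M A f")
  case True
  then show ?thesis
    using assms by (simp add: set_integral_add)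
next
  case False
  have "\<not> set_integrable M A (\<lambda>x. f x + g x)"
  proof
    assume "set_integrable M A (\<lambda>x. f x + g x)"
    from set_integral_diff(1)[OF this assms(1)] False show False
      by simp
  qed
  then show ?thesis
    using False
    by (simp add: set_integrable_def set_lebesgue_integral_def not_integrable_integral_eq)
qed

section \<open>Weak solutions under the affine change\<close>

text \<open>Constants are integrable on compact sets, and \<open>c\<close> cancels in differences,
  which are just scaled by \<open>s\<close>.\<close>

lemma continuous_into_L1loc_affine:
  assumes "continuous_into_L1loc u"
  shows "continuous_into_L1loc (\<lambda>p. s * u p + c)"
  unfolding continuous_into_L1loc_def
proof (intro allI impI conjI)
  fix t :: real and C :: "real set"
  assume t: "0 \<le> t" and C: "compact C"
  have "C \<in> lmeasurable"
    using C by (rule lmeasurable_compact)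
  then have "set_integrable lebesgue C (\<lambda>x. c)"
    by (auto simp: set_integrable_def fmeasurable_def intro: integrable_mult_left)
  moreover have "set_integrable lebesgue C (\<lambda>x. u (x, t))"
    using assms t C by (auto simp: continuous_into_L1loc_def)
  ultimately show "set_integrable lebesgue C (\<lambda>x. s * u (x, t) + c)"
    by (intro set_integral_add set_integrable_mult_right) auto
  have "((\<lambda>r. \<bar>s\<bar> * (LINT x:C|lebesgue. \<bar>u (x, r) - u (x, t)\<bar>)) \<longlongrightarrow> \<bar>s\<bar> * 0)
      (at t within {0..})"
    using assms t C by (intro tendsto_mult_left) (auto simp: continuous_into_L1loc_def)
  moreover have "\<bar>(s * u (x, r) + c) - (s * u (x, t) + c)\<bar> = \<bar>s\<bar> * \<bar>u (x, r) - u (x, t)\<bar>" for x r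
    by (simp add: abs_mult[symmetric] algebra_simps)
  ultimately show "((\<lambda>r. LINT x:C|lebesgue. \<bar>(s * u (x, r) + c) - (s * u (x, t) + c)\<bar>) \<longlongrightarrow> 0)
      (at t within {0..})"
    by simp
qed

text \<open>Since \<open>s * s = 1\<close>, the new flux at the new solution is
  \<open>s * \<phi> (u p) + K\<close>. The new integrand is therefore \<open>s\<close> times the old
  one plus a term of integral 0.\<close>

lemma weak_solution_affine:
  assumes "weak_solution \<phi> J u0 u" and "s * s = 1"
  shows "weak_solution (\<lambda>v. s * \<phi> (s * (v - c)) + K) ((\<lambda>r. s * r + c) ` J)
    (\<lambda>x. s * u0 x + c) (\<lambda>p. s * u p + c)"
proof -
  note sol = assms(1)[unfolded weak_solution_def]
  have "bounded ((\<lambda>p. s * u p + c) ` (UNIV \<times> {0..}))"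
  proof -
    have "bounded ((\<lambda>v. c + v) ` (\<lambda>v. s *\<^sub>R v) ` u ` (UNIV \<times> {0..}))"
      using sol by (intro bounded_translation bounded_scaling) auto
    then show ?thesis
      by (simp add: image_image add.commute)
  qed
  moreover have "(\<lambda>p. s * u p + c) \<in> borel_measurable (lebesgue_on (UNIV \<times> {0..}))"
    using sol by (intro borel_measurable_add borel_measurable_times) auto
  moreover have "AE x in lebesgue. s * u (x, 0) + c = s * u0 x + c"
    using sol by (auto elim: eventually_mono)
  moreover have "(LINT p:half_plane|lebesgue. partial_t \<psi> p * (s * u p + c) +
      partial_x \<psi> p * (s * \<phi> (s * (s * u p + c - c)) + K)) = 0"
    if "smooth \<psi>" "compact_support_in half_plane \<psi>" for \<psi>
  proof -
    have ss: "s * (s * r) = r" for r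
      using assms(2) by (simp flip: mult.assoc)
    have "C_k 1 \<psi>"
      using that(1) by (simp add: smooth_def)
    note const = constants_weakly_trivial[OF this that(2), of c K]
    have "(LINT p:half_plane|lebesgue. partial_t \<psi> p * (s * u p + c) +
        partial_x \<psi> p * (s * \<phi> (s * (s * u p + c - c)) + K)) =
      (LINT p:half_plane|lebesgue. s * (partial_t \<psi> p * u p + partial_x \<psi> p * \<phi> (u p)) +
        (c * partial_t \<psi> p + K * partial_x \<psi> p))"
      by (simp add: ss algebra_simps)
    also have "\<dots> =
        (LINT p:half_plane|lebesgue. s * (partial_t \<psi> p * u p + partial_x \<psi> p * \<phi> (u p)))"
      by (rule set_lebesgue_integral_add_null[OF const])
    also have "\<dots> = 0"
      using sol that by simp
    finally show ?thesis .
  qed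
  ultimately show ?thesis
    using sol continuous_into_L1loc_affine[of u s c] by (auto simp: weak_solution_def)
qed

section \<open>Convex extensions and entropy admissibility\<close>

text \<open>Extensions of the new flux are pulled back to the old one, as needed to test the old
  solution with them. Composition multiplies the derivatives of \<open>E\<close> and
  \<open>Q\<close> by the same factor \<open>s\<close>, so their relation survives once the flux
  derivatives agree.\<close>

lemma convex_extension_affine:
  assumes ext: "convex_extension (\<lambda>v. s * \<phi> (s * (v - c)) + K) E Q"
    and s: "s * s = 1" and \<phi>: "\<And>v. \<phi> differentiable (at v)"
  shows "convex_extension \<phi> (\<lambda>v. E (s * v + c)) (\<lambda>v. Q (s * v + c))"
proof -
  note ext' = ext[unfolded convex_extension_def]
  have ss: "s * (s * r) = r" for r
    using s by (simp flip: mult.assoc)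
  have D: "(F has_real_derivative deriv F v) (at v)" if "F differentiable (at v)"
    for F :: "real \<Rightarrow> real" and v
    using that by (simp add: DERIV_deriv_iff_real_differentiable)
  have aff: "deriv (\<lambda>v. F (s * v + c)) v = s * deriv F (s * v + c)"
    if "C_k 1 F" for F and v
  proof -
    have "(F has_real_derivative deriv F (s * v + c)) (at (s * v + c))"
      using that by (intro D) simp
    then have "((\<lambda>v. F (s * v + c)) has_real_derivative deriv F (s * v + c) * s) (at v)"
      by (rule DERIV_chain2) (auto intro!: derivative_eq_intros)
    then show ?thesis
      by (simp add: DERIV_imp_deriv mult.commute)
  qed
  \<comment> \<open>One factor \<open>s\<close> comes from outside \<open>\<phi>\<close> and one
    from the chain rule; their product is 1, and \<open>K\<close> has derivative 0.\<close>
  have flux: "deriv (\<lambda>v. s * \<phi> (s * (v - c)) + K) (s * v + c) = deriv \<phi> v" for v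
  proof -
    have "(\<phi> has_real_derivative deriv \<phi> v) (at (s * (s * v + c - c)))"
      using D[OF \<phi>, of v] by (simp add: ss)
    then have "((\<lambda>w. \<phi> (s * (w - c))) has_real_derivative deriv \<phi> v * s) (at (s * v + c))"
      by (rule DERIV_chain2) (auto intro!: derivative_eq_intros)
    then have "((\<lambda>w. s * \<phi> (s * (w - c)) + K) has_real_derivative s * (deriv \<phi> v * s))
        (at (s * v + c))"
      by (auto intro!: derivative_eq_intros)
    then show ?thesis
      by (simp add: DERIV_imp_deriv mult.commute[of _ s] ss)
  qed
  have "convex_on UNIV (\<lambda>v. E (s * v + c))"
  proof (rule convex_onI)
    fix t x y :: real
    assume t: "0 < t" "t < 1"
    have "s * ((1 - t) *\<^sub>R x + t *\<^sub>R y) + c = (1 - t) *\<^sub>R (s * x + c) + t *\<^sub>R (s * y + c)"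
      by (simp add: algebra_simps)
    moreover have "E ((1 - t) *\<^sub>R (s * x + c) + t *\<^sub>R (s * y + c)) \<le>
        (1 - t) * E (s * x + c) + t * E (s * y + c)"
      using ext' t by (intro convex_onD[of UNIV E]) auto
    ultimately show "E (s * ((1 - t) *\<^sub>R x + t *\<^sub>R y) + c) \<le>
        (1 - t) * E (s * x + c) + t * E (s * y + c)"
      by simp
  qed simp
  moreover have "C_k k (\<lambda>v. E (s * v + c))" for k
    using ext' by (intro C_k_affine) (simp add: smooth_def)
  moreover have "C_k 1 (\<lambda>v. Q (s * v + c))"
    using ext' by (intro C_k_affine) simp
  moreover have "deriv (\<lambda>v. Q (s * v + c)) v = deriv (\<lambda>v. E (s * v + c)) v * deriv \<phi> v" for v
    using ext' by (simp only: aff flux mult.assoc)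
  ultimately show ?thesis
    unfolding convex_extension_def smooth_def by blast
qed

text \<open>The pulled-back pair at \<open>u p\<close> is \<open>E\<close> and \<open>Q\<close> at
  \<open>s * u p + c\<close>, so both entropy inequalities have the same integrand for each test
  function.\<close>

lemma entropy_admissible_weak_solution_affine:
  assumes u: "entropy_admissible_weak_solution \<phi> J u0 u"
    and s: "s * s = 1" and \<phi>: "\<And>v. \<phi> differentiable (at v)"
  shows "entropy_admissible_weak_solution (\<lambda>v. s * \<phi> (s * (v - c)) + K) ((\<lambda>r. s * r + c) ` J)
    (\<lambda>x. s * u0 x + c) (\<lambda>p. s * u p + c)"
  using u weak_solution_affine[OF _ s] convex_extension_affine[OF _ s \<phi>]
  unfolding entropy_admissible_weak_solution_def by blast

lemma entropy_admissible_weak_solution_affine_iff: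
  assumes s: "s * s = 1" and \<phi>: "\<And>v. \<phi> differentiable (at v)"
  shows "entropy_admissible_weak_solution \<phi> J u0 u \<longleftrightarrow>
    entropy_admissible_weak_solution (\<lambda>v. s * \<phi> (s * (v - c)) + K) ((\<lambda>r. s * r + c) ` J)
      (\<lambda>x. s * u0 x + c) (\<lambda>p. s * u p + c)"
    (is "_ \<longleftrightarrow> entropy_admissible_weak_solution ?g ?J ?init ?sol")
proof
  show "entropy_admissible_weak_solution \<phi> J u0 u \<Longrightarrow>
      entropy_admissible_weak_solution ?g ?J ?init ?sol"
    by (rule entropy_admissible_weak_solution_affine[OF _ s \<phi>])
  have ss: "s * (s * r) = r" for r
    using s by (simp flip: mult.assoc)
  have g: "?g differentiable (at v)" for v
  proof -
    have "(\<phi> has_real_derivative deriv \<phi> (s * (v - c))) (at (s * (v - c)))"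
      using \<phi> by (simp add: DERIV_deriv_iff_real_differentiable)
    then have "((\<lambda>w. \<phi> (s * (w - c))) has_real_derivative deriv \<phi> (s * (v - c)) * s) (at v)"
      by (rule DERIV_chain2) (auto intro!: derivative_eq_intros)
    then have "(\<lambda>w. \<phi> (s * (w - c))) differentiable (at v)"
      by (auto simp: real_differentiable_def)
    then show ?thesis
      by (intro derivative_intros)
  qed
  assume "entropy_admissible_weak_solution ?g ?J ?init ?sol"
  \<comment> \<open>The inverse of \<open>r \<mapsto> s * r + c\<close> is
    \<open>r \<mapsto> s * r - s * c\<close>. The outer factor \<open>s\<close> of the flux turns
    \<open>K\<close> into \<open>s * K\<close>, which the new constant removes.\<close>
  from entropy_admissible_weak_solution_affine[OF this s g, of "- s * c" "- s * K"]
  show "entropy_admissible_weak_solution \<phi> J u0 u"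
    by (simp add: ss image_image distrib_left)
qed

section \<open>Equivalence of the two Cauchy problems\<close>

theorem proposition2p6:
  fixes f h g :: "real \<Rightarrow> real" and a b L K :: real
    and \<rho>0 \<sigma>0 :: "real \<Rightarrow> real" and I' :: "real set"
  assumes "smooth f"
    and "a \<le> b"
    and "\<rho>0 \<in> borel_measurable lebesgue"
    and "\<And>x. \<rho>0 x \<in> {a..b}"
    and "a \<le> 0 \<and> 0 \<le> b \<Longrightarrow> (\<lambda>r. r + L) ` {a..b} \<subseteq> {0<..}"
    and "I' = new_interval a b L"
    and "h = new_flux f a b L"
    and "K < (INF \<sigma>\<in>I'. \<sigma> * deriv h \<sigma> - h \<sigma>)"
    and "g = (\<lambda>\<sigma>. h \<sigma> + K)"
    and "\<sigma>0 = (\<lambda>x. change_unknown a b L (\<rho>0 x))"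
  shows "\<forall>\<rho> :: real \<times> real \<Rightarrow> real.
           entropy_admissible_weak_solution f {a..b} \<rho>0 \<rho> \<longleftrightarrow>
           entropy_admissible_weak_solution g I' \<sigma>0 (\<lambda>p. change_unknown a b L (\<rho> p))"
proof
  fix \<rho> :: "real \<times> real \<Rightarrow> real"
  have diff: "f differentiable (at v)" for v
    using assms(1) by (rule smooth_imp_differentiable)
  \<comment> \<open>The three cases are the pairs \<open>(1, 0)\<close>, \<open>(1, L)\<close> and
    \<open>(- 1, 0)\<close> for \<open>(s, c)\<close>.\<close>
  obtain s c where s: "s * s = 1"
    and unknown: "change_unknown a b L = (\<lambda>r. s * r + c)"
    and interval: "new_interval a b L = (\<lambda>r. s * r + c) ` {a..b}"
    and flux: "new_flux f a b L = (\<lambda>v. s * f (s * (v - c)))"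
  proof -
    consider "a > 0" | "a \<le> 0" "0 \<le> b" | "b < 0"
      by linarith
    then show thesis
    proof cases
      case 1
      then show thesis
        by (intro that[of 1 0])
          (auto simp: fun_eq_iff change_unknown_def new_interval_def new_flux_def)
    next
      case 2
      then show thesis
        by (intro that[of 1 L])
          (auto simp: fun_eq_iff change_unknown_def new_interval_def new_flux_def)
    next
      \<comment> \<open>Here \<open>a \<le> b\<close> makes \<open>a\<close> negative too, so the
        definitions take their last branch.\<close>
      case 3
      then show thesis
        using assms(2) by (intro that[of "- 1" 0])
          (auto simp: fun_eq_iff change_unknown_def new_interval_def new_flux_def)
    qed
  qed
  show "entropy_admissible_weak_solution f {a..b} \<rho>0 \<rho> \<longleftrightarrow>
      entropy_admissible_weak_solution g I' \<sigma>0 (\<lambda>p. change_unknown a b L (\<rho> p))"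
    unfolding assms(6,7,9,10) unknown interval flux
    by (rule entropy_admissible_weak_solution_affine_iff[OF s diff])
qed

end
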